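(* Let $\mathbf{N}=(V,H,s,t)$ and $\mathbf{N}'=(V',H',s',t')$ be two hypernetworks and $\phi:\mathbf{N}\to\mathbf{N}'$ a hypergraph fibration. Let $f^{\mathbf{N}}:\bigoplus_{v\in V}\mathbb{R}^{n_v}\to\bigoplus_{v\in V}\mathbb{R}^{n_v}$ and $f^{\mathbf{N}'}:\bigoplus_{v'\in V'}\mathbb{R}^{n_{v'}}\to\bigoplus_{v'\in V'}\mathbb{R}^{n_{v'}}$ be admissible maps for $\mathbf{N}$ and $\mathbf{N}'$ respectively, where vertices of the same type (in $V\cup V'$) have the same internal phase space; that is, $$f^{\mathbf{N}}_v\Big(\bigoplus_{w\in V}x_w\Big)=F_v\Big(\bigoplus_{h:\,t(h)=v}\mathbf{x}_{s(h)}\Big),\qquad f^{\mathbf{N}'}_{v'}\Big(\bigoplus_{w'\in V'}x_{w'}\Big)=F'_{v'}\Big(\bigoplus_{h':\,t'(h')=v'}\mathbf{x}_{s'(h')}\Big),$$ where $\mathbf{x}_{s(h)}=(x_{s_1(h)},\ldots,x_{s_k(h)})$ and $\mathbf{x}_{s'(h')}=(x_{s'_1(h')},\ldots,x_{s'_{k'}(h')})$. Assume that for all vertices $v\in V$ and $v'\in V'$ of the same type and every hyperedge-type-preserving bijection $\alpha:t^{-1}(v)\to(t')^{-1}(v')$ it holds that $$F_v\Big(\bigoplus_{h:\,t(h)=v}\mathbf{x}_{s'(\alpha(h))}\Big)=F'_{v'}\Big(\bigoplus_{h':\,t'(h')=v'}\mathbf{x}_{s'(h')}\Big)$$ for all $x\in\bigoplus_{w'\in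 V'}\mathbb{R}^{n_{w'}}$. Then the linear map $R_\phi:\bigoplus_{v'\in V'}\mathbb{R}^{n_{v'}}\to\bigoplus_{v\in V}\mathbb{R}^{n_v}$ defined by $$R_\phi\Big(\bigoplus_{v'\in V'}x_{v'}\Big)=\bigoplus_{v\in V}x_{\phi(v)}$$ is a semiconjugacy between the admissible maps, that is, $R_\phi\circ f^{\mathbf{N}'}=f^{\mathbf{N}}\circ R_\phi$. In particular, $R_\phi$ sends solution curves of $\dot y=f^{\mathbf{N}'}(y)$ on $\bigoplus_{v'\in V'}\mathbb{R}^{n_{v'}}$ to solution curves of $\dot x=f^{\mathbf{N}}(x)$ on $\bigoplus_{v\in V}\mathbb{R}^{n_v}$.
   Context: **Hypernetwork.** A hypernetwork is a tuple $\mathbf{N}=(V,H,s,t)$ with $V$ a finite set of vertices and $H$ a finite set of hyperedges. The map $s$ assigns to each hyperedge $h$ a finite ordered list of source vertices $s(h)=(s_1(h),\ldots,s_k(h))\in V^k$ (repetitions allowed; $k$ is the order of $h$). The map $t:H\to V$ assigns to each hyperedge a unique target vertex. All vertices and hyperedges are assigned a type (from some finite set) such that: (1) if $h_1,h_2\in H$ have the same type, then they have equal order, $s_i(h_1)$ and $s_i(h_2)$ have the same type for each $i$, and $t(h_1)$, $t(h_2)$ have the same type; (2) if $v_1,v_2\in V$ have the same type, then there is a type-preserving bijection $t^{-1}(v_1)\to t^{-1}(v_2)$. **Admissible maps.** Given internal phase spaces $\mathbb{R}^{n_v}$ with $n_{v_1}=n_{v_2}$ whenever $v_1,v_2$ have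 the same type, a map $f$ on $\bigoplus_{v\in V}\mathbb{R}^{n_v}$ is $\mathbf{N}$-admissible if $f_v(x)=F_v\big(\bigoplus_{h:\,t(h)=v}\mathbf{x}_{s(h)}\big)$ for response functions $F_v$ (arguments indexed by the hyperedges targeting $v$) such that for any vertices $v_1,v_2$ of the same type (possibly equal) and any hyperedge-type-preserving bijection $\alpha:t^{-1}(v_1)\to t^{-1}(v_2)$ one has $F_{v_2}\big(\bigoplus_{t(h_2)=v_2}\mathbf{X}_{h_2}\big)=F_{v_1}\big(\bigoplus_{t(h_1)=v_1}\mathbf{X}_{\alpha(h_1)}\big)$ as an identity in the inputs (in particular with $\mathbf{X}_h=\mathbf{x}_{s(h)}$). **Hypergraph fibration.** A map $\phi:\mathbf{N}\to\mathbf{N}'$ between hypernetworks $\mathbf{N}=(V,H,s,t)$ and $\mathbf{N}'=(V',H',s',t')$ (types taken from common sets) is a hypergraph fibration if: (1) $\phi(v)\in V'$ for all $v\in V$; (2) $\phi(h)\in H'$ for all $h\in H$; (3) $\phi(v)$ and $v$, as well as $\phi(h)$ and $h$, are of the same type for all $v\in V$, $h\in H$; (4) for every $h\in H$ of order $k$, $s'(\phi(h))=(\phi(s_1(h)),\ldots,\phi(s_k(h)))$; (5) $t'(\phi(h))=\phi(t(h))$ for all $h\in H$; (6) for every $v\in V$ the restriction $\phi|_{t^{-1}(v)}:t^{-1}(v)\to(t')^{-1}(\phi(v))$ is a type-preserving bijection of hyperedges. *)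

theory Defs
  imports "HOL-Analysis.Analysis" "HOL-Library.Function_Algebras"
begin

section \<open>Hypernetworks\<close>

record ('v, 'h, 'vt, 'ht) hypernet =
  verts :: "'v set"
  hedges :: "'h set"
  srcs :: "'h \<Rightarrow> 'v list"
  tgt :: "'h \<Rightarrow> 'v"
  vtype :: "'v \<Rightarrow> 'vt"
  htype :: "'h \<Rightarrow> 'ht"

definition in_edges :: "('v, 'h, 'vt, 'ht) hypernet \<Rightarrow> 'v \<Rightarrow> 'h set"
  where "in_edges N v = {h \<in> hedges N. tgt N h = v}"

text \<open>The two vertices may belong to different hypernetworks, whose types are drawn from
  common type sets.\<close>

definition type_bij ::
    "('v, 'h, 'vt, 'ht) hypernet \<Rightarrow> 'v \<Rightarrow> ('w, 'g, 'vt, 'ht) hypernet \<Rightarrow> 'w \<Rightarrow> ('h \<Rightarrow> 'g) \<Rightarrow> bool"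
  where "type_bij N v N' v' \<alpha> \<longleftrightarrow>
    bij_betw \<alpha> (in_edges N v) (in_edges N' v') \<and>
    (\<forall>h \<in> in_edges N v. htype N' (\<alpha> h) = htype N h)"

text \<open>The order of a hyperedge \<open>h\<close> is \<open>length (srcs N h)\<close>. Only finitely many types occur since
  there are finitely many vertices and hyperedges.\<close>

definition hypernetwork :: "('v, 'h, 'vt, 'ht) hypernet \<Rightarrow> bool"
  where "hypernetwork N \<longleftrightarrow>
    finite (verts N) \<and> finite (hedges N) \<and>
    (\<forall>h \<in> hedges N. set (srcs N h) \<subseteq> verts N \<and> tgt N h \<in> verts N) \<and>
    (\<forall>h1 \<in> hedges N. \<forall>h2 \<in> hedges N. htype N h1 = htype N h2 \<longrightarrow>
       length (srcs N h1) = length (srcs N h2) \<and>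
       (\<forall>i < length (srcs N h1). vtype N (srcs N h1 ! i) = vtype N (srcs N h2 ! i)) \<and>
       vtype N (tgt N h1) = vtype N (tgt N h2)) \<and>
    (\<forall>v1 \<in> verts N. \<forall>v2 \<in> verts N. vtype N v1 = vtype N v2 \<longrightarrow>
       (\<exists>\<alpha>. type_bij N v1 N v2 \<alpha>))"

definition hypergraph_fibration ::
    "('v, 'h, 'vt, 'ht) hypernet \<Rightarrow> ('w, 'g, 'vt, 'ht) hypernet \<Rightarrow> ('v \<Rightarrow> 'w) \<Rightarrow> ('h \<Rightarrow> 'g) \<Rightarrow> bool"
  where "hypergraph_fibration N N' \<phi>V \<phi>H \<longleftrightarrow>
    (\<forall>v \<in> verts N. \<phi>V v \<in> verts N') \<and>
    (\<forall>h \<in> hedges N. \<phi>H h \<in> hedges N') \<and>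
    (\<forall>v \<in> verts N. vtype N' (\<phi>V v) = vtype N v) \<and>
    (\<forall>h \<in> hedges N. htype N' (\<phi>H h) = htype N h) \<and>
    (\<forall>h \<in> hedges N. srcs N' (\<phi>H h) = map \<phi>V (srcs N h)) \<and>
    (\<forall>h \<in> hedges N. tgt N' (\<phi>H h) = \<phi>V (tgt N h)) \<and>
    (\<forall>v \<in> verts N. type_bij N v N' (\<phi>V v) \<phi>H)"

section \<open>Phase spaces and admissible maps\<close>

text \<open>The internal phase space of a vertex of type \<open>\<tau>\<close> has dimension \<open>n \<tau>\<close>: letting the dimension
  depend on the type is how vertices of equal type (in one or in several hypernetworks) get equal
  phase spaces. The points of \<open>Euclidean_space n\<close> are the sequences that vanish from
  index \<open>n\<close> on.\<close>

abbreviation internal_space :: "('v, 'h, 'vt, 'ht) hypernet \<Rightarrow> ('vt \<Rightarrow> nat) \<Rightarrow> 'v \<Rightarrow> (nat \<Rightarrow> real) set"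
  where "internal_space N n v \<equiv> topspace (Euclidean_space (n (vtype N v)))"

text \<open>Points of the direct sum are functions on the vertex type that vanish outside of the vertex
  set, so that the total phase space is a linear subspace for the pointwise operations.\<close>

definition phase_space :: "('v, 'h, 'vt, 'ht) hypernet \<Rightarrow> ('vt \<Rightarrow> nat) \<Rightarrow> ('v \<Rightarrow> nat \<Rightarrow> real) set"
  where "phase_space N n = {x. (\<forall>v \<in> verts N. x v \<in> internal_space N n v) \<and> (\<forall>v. v \<notin> verts N \<longrightarrow> x v = 0)}"

definition state_scale :: "real \<Rightarrow> ('v \<Rightarrow> nat \<Rightarrow> real) \<Rightarrow> 'v \<Rightarrow> nat \<Rightarrow> real"
  where "state_scale c x = (\<lambda>v i. c * x v i)"

lemma vector_space_state_scale: "vector_space (state_scale :: real \<Rightarrow> ('v \<Rightarrow> nat \<Rightarrow> real) \<Rightarrow> _)"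
  by unfold_locales (auto simp: state_scale_def fun_eq_iff algebra_simps)

lemma subspace_phase_space: "module.subspace state_scale (phase_space N n)"
proof -
  interpret vector_space "state_scale :: real \<Rightarrow> ('v \<Rightarrow> nat \<Rightarrow> real) \<Rightarrow> _"
    by (rule vector_space_state_scale)
  show ?thesis
    by (auto simp: subspace_def phase_space_def state_scale_def topspace_Euclidean_space fun_eq_iff)
qed

text \<open>The inputs of a response function \<open>F v\<close>: the component of a hyperedge \<open>h\<close> targeting \<open>v\<close> is
  a list of internal states of the types prescribed by the sources of \<open>h\<close>.\<close>

definition input_space ::
    "('v, 'h, 'vt, 'ht) hypernet \<Rightarrow> ('vt \<Rightarrow> nat) \<Rightarrow> 'v \<Rightarrow> ('h \<Rightarrow> (nat \<Rightarrow> real) list) set"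
  where "input_space N n v =
    (\<Pi>\<^sub>E h \<in> in_edges N v. listset (map (internal_space N n) (srcs N h)))"

text \<open>The response functions are required to be compatible on all inputs, not just on those of the
  form \<open>\<lambda>h. map x (srcs N h)\<close>.\<close>

definition admissible_map ::
    "('v, 'h, 'vt, 'ht) hypernet \<Rightarrow> ('vt \<Rightarrow> nat) \<Rightarrow>
     ('v \<Rightarrow> ('h \<Rightarrow> (nat \<Rightarrow> real) list) \<Rightarrow> (nat \<Rightarrow> real)) \<Rightarrow>
     (('v \<Rightarrow> nat \<Rightarrow> real) \<Rightarrow> ('v \<Rightarrow> nat \<Rightarrow> real)) \<Rightarrow> bool"
  where "admissible_map N n F f \<longleftrightarrow>
    (\<forall>v \<in> verts N. F v \<in> input_space N n v \<rightarrow> internal_space N n v) \<and>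
    (\<forall>v1 \<in> verts N. \<forall>v2 \<in> verts N. \<forall>\<alpha>. vtype N v1 = vtype N v2 \<longrightarrow> type_bij N v1 N v2 \<alpha> \<longrightarrow>
       (\<forall>X \<in> input_space N n v2. F v2 X = F v1 (\<lambda>h \<in> in_edges N v1. X (\<alpha> h)))) \<and>
    f \<in> phase_space N n \<rightarrow> phase_space N n \<and>
    (\<forall>x \<in> phase_space N n. \<forall>v \<in> verts N. f x v = F v (\<lambda>h \<in> in_edges N v. map x (srcs N h)))"

definition R_map ::
    "('v, 'h, 'vt, 'ht) hypernet \<Rightarrow> ('v \<Rightarrow> 'w) \<Rightarrow> ('w \<Rightarrow> nat \<Rightarrow> real) \<Rightarrow> ('v \<Rightarrow> nat \<Rightarrow> real)"
  where "R_map N \<phi>V x = (\<lambda>v. if v \<in> verts N then x (\<phi>V v) else 0)"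

text \<open>Solution curves on a nondegenerate interval \<open>J\<close> (open or not, bounded or not). The phase space
  is finite-dimensional, so the derivative is taken coordinatewise; it is one-sided at endpoints
  of \<open>J\<close>.\<close>

definition solution_curve ::
    "('v, 'h, 'vt, 'ht) hypernet \<Rightarrow> ('vt \<Rightarrow> nat) \<Rightarrow> (('v \<Rightarrow> nat \<Rightarrow> real) \<Rightarrow> ('v \<Rightarrow> nat \<Rightarrow> real)) \<Rightarrow>
     real set \<Rightarrow> (real \<Rightarrow> 'v \<Rightarrow> nat \<Rightarrow> real) \<Rightarrow> bool"
  where "solution_curve N n f J y \<longleftrightarrow>
    is_interval J \<and> interior J \<noteq> {} \<and>
    (\<forall>t \<in> J. y t \<in> phase_space N n) \<and>
    (\<forall>t \<in> J. \<forall>v \<in> verts N. \<forall>i < n (vtype N v).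
       ((\<lambda>u. y u v i) has_real_derivative f (y t) v i) (at t within J))"

end

theory Submission
  imports Defs
begin

text \<open>The state \<open>R_map N \<phi>V x\<close> gives each vertex \<open>v\<close> the state
  of its image \<open>\<phi>V v\<close>. Since a fibration carries the source list of
  \<open>h\<close> to that of \<open>\<phi>H h\<close>, the hyperedge \<open>h\<close> reads from
  this state exactly what \<open>\<phi>H h\<close> reads from \<open>x\<close>
  (\<open>map_R_map_srcs\<close>). On the hyperedges targeting \<open>v\<close>,
  \<open>\<phi>H\<close> is a type-preserving bijection onto those targeting
  \<open>\<phi>V v\<close>, so the compatibility of \<open>F\<close> with \<open>F'\<close> applies
  with \<open>\<alpha>\<close> = \<open>\<phi>H\<close> and gives the semiconjugacy at
  \<open>v\<close>. Solution curves are then transported coordinatewise: each coordinate of the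
  image curve is a coordinate of the original one, and the semiconjugacy identifies its
  derivative.\<close>

lemma linear_R_map:
  fixes N :: "('v, 'h, 'vt, 'ht) hypernet" and \<phi>V :: "'v \<Rightarrow> 'w"
  shows "Vector_Spaces.linear state_scale state_scale (R_map N \<phi>V)"
proof -
  interpret vector_space_pair "state_scale :: real \<Rightarrow> ('w \<Rightarrow> nat \<Rightarrow> real) \<Rightarrow> _"
      "state_scale :: real \<Rightarrow> ('v \<Rightarrow> nat \<Rightarrow> real) \<Rightarrow> _"
    by (intro vector_space_pair.intro vector_space_state_scale)
  show ?thesis
    by unfold_locales (auto simp: R_map_def state_scale_def fun_eq_iff)
qed

text \<open>Fibrations preserve vertex types, and the type alone fixes the dimension of the internal
  space, so \<open>v\<close> may take over the state of \<open>\<phi>V v\<close>.\<close>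

lemma R_map_in_phase_space:
  assumes "hypergraph_fibration N N' \<phi>V \<phi>H" "x \<in> phase_space N' n"
  shows "R_map N \<phi>V x \<in> phase_space N n"
proof -
  have "x (\<phi>V v) \<in> internal_space N n v" if "v \<in> verts N" for v
  proof -
    have "\<phi>V v \<in> verts N'" "vtype N' (\<phi>V v) = vtype N v"
      using assms(1) that by (auto simp: hypergraph_fibration_def)
    then show ?thesis
      using assms(2) by (force simp: phase_space_def)
  qed
  then show ?thesis
    by (simp add: phase_space_def R_map_def)
qed

text \<open>This turns inputs in \<open>N\<close> into inputs in \<open>N'\<close>. That the sources
  of \<open>h\<close> lie in \<open>verts N\<close> matters: elsewhere \<open>R_map\<close> returns
  0 instead of the state at the image.\<close>

lemma map_R_map_srcs:
  assumes "hypernetwork N" "hypergraph_fibration N N' \<phi>V \<phi>H" "h \<in> hedges N"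
  shows "map (R_map N \<phi>V x) (srcs N h) = map x (srcs N' (\<phi>H h))"
proof -
  have "set (srcs N h) \<subseteq> verts N"
    using assms by (auto simp: hypernetwork_def)
  moreover have "srcs N' (\<phi>H h) = map \<phi>V (srcs N h)"
    using assms by (auto simp: hypergraph_fibration_def)
  ultimately show ?thesis
    by (auto simp: R_map_def)
qed

theorem theorem3p4:
  fixes N :: "('v, 'h, 'vt, 'ht) hypernet"
    and N' :: "('w, 'g, 'vt, 'ht) hypernet"
    and \<phi>V :: "'v \<Rightarrow> 'w" and \<phi>H :: "'h \<Rightarrow> 'g"
    and n :: "'vt \<Rightarrow> nat"
    and F :: "'v \<Rightarrow> ('h \<Rightarrow> (nat \<Rightarrow> real) list) \<Rightarrow> (nat \<Rightarrow> real)"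
    and F' :: "'w \<Rightarrow> ('g \<Rightarrow> (nat \<Rightarrow> real) list) \<Rightarrow> (nat \<Rightarrow> real)"
    and f :: "('v \<Rightarrow> nat \<Rightarrow> real) \<Rightarrow> ('v \<Rightarrow> nat \<Rightarrow> real)"
    and f' :: "('w \<Rightarrow> nat \<Rightarrow> real) \<Rightarrow> ('w \<Rightarrow> nat \<Rightarrow> real)"
  assumes "hypernetwork N" and "hypernetwork N'"
    and "hypergraph_fibration N N' \<phi>V \<phi>H"
    and "admissible_map N n F f" and "admissible_map N' n F' f'"
    and "\<And>v v' \<alpha> x. v \<in> verts N \<Longrightarrow> v' \<in> verts N' \<Longrightarrow> vtype N v = vtype N' v' \<Longrightarrow>
           type_bij N v N' v' \<alpha> \<Longrightarrow> x \<in> phase_space N' n \<Longrightarrow>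
           F v (\<lambda>h \<in> in_edges N v. map x (srcs N' (\<alpha> h))) =
           F' v' (\<lambda>h' \<in> in_edges N' v'. map x (srcs N' h'))"
  shows "Vector_Spaces.linear state_scale state_scale (R_map N \<phi>V)
    \<and> R_map N \<phi>V \<in> phase_space N' n \<rightarrow> phase_space N n
    \<and> (\<forall>x \<in> phase_space N' n. (R_map N \<phi>V \<circ> f') x = (f \<circ> R_map N \<phi>V) x)
    \<and> (\<forall>J y. solution_curve N' n f' J y \<longrightarrow> solution_curve N n f J (R_map N \<phi>V \<circ> y))"
proof -
  note fib = assms(3)
  have vert: "\<phi>V v \<in> verts N'" "vtype N' (\<phi>V v) = vtype N v" "type_bij N v N' (\<phi>V v) \<phi>H"
    if "v \<in> verts N" for v
    using fib that by (auto simp: hypergraph_fibration_def)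
  have f_in: "f x \<in> phase_space N n" if "x \<in> phase_space N n" for x
    using assms(4) that by (auto simp: admissible_map_def)
  have f_eq: "f x v = F v (\<lambda>h \<in> in_edges N v. map x (srcs N h))"
    if "x \<in> phase_space N n" "v \<in> verts N" for x v
    using assms(4) that by (simp add: admissible_map_def)
  have f'_eq: "f' x v = F' v (\<lambda>h \<in> in_edges N' v. map x (srcs N' h))"
    if "x \<in> phase_space N' n" "v \<in> verts N'" for x v
    using assms(5) that by (simp add: admissible_map_def)
  have semiconj: "R_map N \<phi>V (f' x) = f (R_map N \<phi>V x)" if x: "x \<in> phase_space N' n" for x
  proof
    fix v
    have Rx: "R_map N \<phi>V x \<in> phase_space N n"
      using R_map_in_phase_space[OF fib x] .
    show "R_map N \<phi>V (f' x) v = f (R_map N \<phi>V x) v"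
    proof (cases "v \<in> verts N")
      case True
      have "(\<lambda>h \<in> in_edges N v. map (R_map N \<phi>V x) (srcs N h)) =
            (\<lambda>h \<in> in_edges N v. map x (srcs N' (\<phi>H h)))"
        by (rule restrict_ext) (simp only: in_edges_def mem_Collect_eq map_R_map_srcs[OF assms(1) fib])
      then have "f (R_map N \<phi>V x) v = F v (\<lambda>h \<in> in_edges N v. map x (srcs N' (\<phi>H h)))"
        using f_eq[OF Rx True] by simp
      also have "\<dots> = f' x (\<phi>V v)"
        \<comment> \<open>Compatibility of the response functions, with \<open>\<phi>V v\<close> for
          \<open>v'\<close> and \<open>\<phi>H\<close> for \<open>\<alpha>\<close>.\<close>
        using assms(6)[OF True _ _ _ x] vert[OF True] f'_eq[OF x] by simp
      finally show ?thesis
        using True by (simp add: R_map_def)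
    next
      case False
      \<comment> \<open>States are functions on the whole vertex type. Off \<open>verts N\<close>
        both sides are 0: the left by definition of \<open>R_map\<close>, the right because
        \<open>f\<close> maps into the phase space.\<close>
      then show ?thesis
        using f_in[OF Rx] by (simp add: R_map_def phase_space_def)
    qed
  qed
  have "solution_curve N n f J (R_map N \<phi>V \<circ> y)" if sol: "solution_curve N' n f' J y" for J y
    unfolding solution_curve_def
  proof (intro conjI ballI allI impI)
    show "is_interval J" "interior J \<noteq> {}"
      using sol by (auto simp: solution_curve_def)
  next
    fix t assume t: "t \<in> J"
    then have yt: "y t \<in> phase_space N' n"
      using sol by (simp add: solution_curve_def)
    then show "(R_map N \<phi>V \<circ> y) t \<in> phase_space N n"
      using R_map_in_phase_space[OF fib] by simp
    fix v i assume v: "v \<in> verts N" and i: "i < n (vtype N v)"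
    \<comment> \<open>Equal types make \<open>i\<close> a valid coordinate index at
      \<open>\<phi>V v\<close> too.\<close>
    have "((\<lambda>u. y u (\<phi>V v) i) has_real_derivative f' (y t) (\<phi>V v) i) (at t within J)"
      using sol t i vert[OF v] by (simp add: solution_curve_def)
    moreover have "f' (y t) (\<phi>V v) i = f (R_map N \<phi>V (y t)) v i"
      unfolding semiconj[OF yt, symmetric] using v by (simp add: R_map_def)
    ultimately show "((\<lambda>u. (R_map N \<phi>V \<circ> y) u v i) has_real_derivative
        f ((R_map N \<phi>V \<circ> y) t) v i) (at t within J)"
      using v by (simp add: R_map_def)
  qed
  then show ?thesis
    using linear_R_map R_map_in_phase_space[OF fib] semiconj by auto
qed

end
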